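(* Let $\mathbf{A}\in\mathbb{R}^{n\times m}$, $\mathbf{y}\in\mathbb{N}^n$, $\bm{\mu}_0\in\mathbb{R}^m$ and $\mathbf{C}_0\in\mathcal{S}_m^+$, and for $(\mathbf{\bar x},\mathbf{C})\in\mathbb{R}^m\times\mathcal{S}_m^+$ let $$F(\mathbf{\bar{x}},\mathbf{C}) = (\mathbf{y},\mathbf{A}\mathbf{\bar{x}})- (\mathbf{1}_n,e^{\mathbf{A}\mathbf{\bar{x}}+\frac{1}{2}\mathrm{diag}(\mathbf{A}\mathbf{C}\mathbf{A}^t)}) - \tfrac{1}{2}(\mathbf{\bar{x}}-\bm{\mu}_0)^t\mathbf{C}^{-1}_0(\mathbf{\bar{x}}-\bm{\mu}_0) - \tfrac{1}{2}\mathrm{tr}(\mathbf{C}^{-1}_0\mathbf{C})+ \tfrac{1}{2}\ln|\mathbf{C}| - \tfrac{1}{2}\ln|\mathbf{C}_0| + \tfrac{m}{2} - (\mathbf{1}_n,\ln(\mathbf{y}!)).$$ Then the gradients of $F$ with respect to $\mathbf{\bar{x}}$ and $\mathbf{C}$ are respectively given by $$\frac{\partial F}{\partial \mathbf{\bar{x}}} = \mathbf{A}^t\mathbf{y} - \mathbf{A}^te^{\mathbf{A}\mathbf{\bar{x}}+\frac{1}{2}\mathrm{diag}(\mathbf{A}\mathbf{C}\mathbf{A}^t)} - \mathbf{C}^{-1}_0(\mathbf{\bar{x}}-\bm{\mu}_0),$$ $$\frac{\partial F}{\partial \mathbf{C}} = \tfrac{1}{2}\left[-\mathbf{A}^t\mathrm{diag}\big(e^{\mathbf{A}\mathbf{\bar{x}}+\frac{1}{2}\mathrm{diag}(\mathbf{A}\mathbf{C}\mathbf{A}^t)}\big)\mathbf{A}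 - \mathbf{C}^{-1}_0 + \mathbf{C}^{-1}\right].$$
   Context: $\mathbb{N}=\{0,1,2,\ldots\}$. $\mathcal{S}_m^+$ is the set of real symmetric positive definite $m\times m$ matrices, $|\cdot|$ is the determinant, the superscript $t$ denotes transpose. $(\cdot,\cdot)$ is the Euclidean inner product for vectors and $(\mathbf{X},\mathbf{Y})=\mathrm{tr}(\mathbf{X}\mathbf{Y}^t)$ for matrices; gradients are taken with respect to these inner products (perturbations of $\mathbf{C}$ being symmetric matrices). $\mathbf{1}_n\in\mathbb{R}^n$ is the all-ones vector. Exponential, logarithm and factorial of a vector are taken componentwise. For a square matrix $\mathbf{M}$, $\mathrm{diag}(\mathbf{M})$ is the vector of its diagonal entries; for a vector $\mathbf{v}$, $\mathrm{diag}(\mathbf{v})$ is the diagonal matrix with diagonal $\mathbf{v}$. *)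

theory Defs
  imports "HOL-Analysis.Analysis"
begin

definition sym_matrices :: "(real ^ 'm ^ 'm) set"
  where "sym_matrices = {M. transpose M = M}"

definition spd_matrices :: "(real ^ 'm ^ 'm) set"
  where "spd_matrices = {M \<in> sym_matrices. \<forall>x. x \<noteq> 0 \<longrightarrow> 0 < x \<bullet> (M *v x)}"

definition diag_of :: "'a ^ 'k ^ 'k \<Rightarrow> 'a ^ 'k"
  where "diag_of M = (\<chi> i. M $ i $ i)"

definition diag_matrix :: "'a::zero ^ 'k \<Rightarrow> 'a ^ 'k ^ 'k"
  where "diag_matrix v = (\<chi> i j. if i = j then v $ i else 0)"

definition exp_vec :: "real ^ 'k \<Rightarrow> real ^ 'k"
  where "exp_vec v = (\<chi> i. exp (v $ i))"

definition ln_vec :: "real ^ 'k \<Rightarrow> real ^ 'k"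
  where "ln_vec v = (\<chi> i. ln (v $ i))"

definition real_vec :: "nat ^ 'k \<Rightarrow> real ^ 'k"
  where "real_vec v = (\<chi> i. real (v $ i))"

definition fact_vec :: "nat ^ 'k \<Rightarrow> nat ^ 'k"
  where "fact_vec v = (\<chi> i. fact (v $ i))"

definition F ::
  "real ^ 'm ^ 'n \<Rightarrow> nat ^ 'n \<Rightarrow> real ^ 'm \<Rightarrow> real ^ 'm ^ 'm \<Rightarrow> real ^ 'm \<Rightarrow> real ^ 'm ^ 'm \<Rightarrow> real"
  where "F A y \<mu>\<^sub>0 C\<^sub>0 xb C =
      real_vec y \<bullet> (A *v xb)
    - (1 :: real ^ 'n) \<bullet> exp_vec (A *v xb + (1/2) *\<^sub>R diag_of (A ** C ** transpose A))
    - 1/2 * ((xb - \<mu>\<^sub>0) \<bullet> (matrix_inv C\<^sub>0 *v (xb - \<mu>\<^sub>0)))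
    - 1/2 * trace (matrix_inv C\<^sub>0 ** C)
    + 1/2 * ln (det C)
    - 1/2 * ln (det C\<^sub>0)
    + real CARD('m) / 2
    - (1 :: real ^ 'n) \<bullet> ln_vec (real_vec (fact_vec y))"

(* Gradient of a function on the cone of positive definite matrices.  The cone is an open
   subset of the space of symmetric matrices, so the gradient is the symmetric G representing
   the derivative along symmetric perturbations.  Without the symmetry requirement G would
   only be determined up to a skew-symmetric summand; with it, G is unique (shown below).
   The inner product on matrices is tr (X Y^t), see inner_matrix_eq_trace. *)
definition has_spd_gradient ::
  "(real ^ 'm ^ 'm \<Rightarrow> real) \<Rightarrow> real ^ 'm ^ 'm \<Rightarrow> real ^ 'm ^ 'm \<Rightarrow> bool"
  where "has_spd_gradient f C G \<longleftrightarrow>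
    G \<in> sym_matrices \<and> (f has_derivative (\<lambda>H. H \<bullet> G)) (at C within spd_matrices)"

lemma inner_matrix_eq_trace:
  fixes X Y :: "real ^ 'a ^ 'b"
  shows "X \<bullet> Y = trace (X ** transpose Y)"
  by (simp add: inner_vec_def trace_def matrix_matrix_mult_def transpose_def)

lemma sym_matrices_add_scaleR:
  assumes "C \<in> sym_matrices" "K \<in> sym_matrices"
  shows "C + t *\<^sub>R K \<in> sym_matrices"
  using assms by (simp add: sym_matrices_def transpose_def vec_eq_iff)

lemma spd_matrices_open_direction:
  fixes C K :: "real ^ 'm ^ 'm"
  assumes C: "C \<in> spd_matrices" and K: "K \<in> sym_matrices"
  obtains e where "0 < e" "\<And>t. \<bar>t\<bar> < e \<Longrightarrow> C + t *\<^sub>R K \<in> spd_matrices"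
proof -
  have cont: "continuous_on (sphere 0 1) (\<lambda>x. x \<bullet> (M *v x))" for M :: "real ^ 'm ^ 'm"
    by (intro continuous_intros linear_continuous_on
        linear_conv_bounded_linear[THEN iffD1] matrix_vector_mul_linear)
  have ne: "sphere (0 :: real ^ 'm) 1 \<noteq> {}" by simp
  obtain u :: "real ^ 'm" where u: "u \<in> sphere 0 1"
    and umin: "\<And>x. x \<in> sphere 0 1 \<Longrightarrow> u \<bullet> (C *v u) \<le> x \<bullet> (C *v x)"
    using continuous_attains_inf[OF compact_sphere ne cont[of C]] by blast
  define c where "c = u \<bullet> (C *v u)"
  have "u \<noteq> 0" using u by auto
  then have cpos: "0 < c" using C by (simp add: c_def spd_matrices_def)
  have "bounded ((\<lambda>x. x \<bullet> (K *v x)) ` sphere 0 1)"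
    by (intro compact_imp_bounded compact_continuous_image cont compact_sphere)
  then obtain B where B: "0 < B" "\<And>x. x \<in> sphere 0 1 \<Longrightarrow> \<bar>x \<bullet> (K *v x)\<bar> \<le> B"
    unfolding bounded_pos by auto
  show thesis
  proof (rule that[of "c / B"])
    show "0 < c / B" using cpos B by simp
    fix t :: real assume t: "\<bar>t\<bar> < c / B"
    have "0 < x \<bullet> ((C + t *\<^sub>R K) *v x)" if x: "x \<noteq> 0" for x :: "real ^ 'm"
    proof -
      define w where "w = (1 / norm x) *\<^sub>R x"
      have w: "w \<in> sphere 0 1" using x by (simp add: w_def)
      have xw: "x = norm x *\<^sub>R w" using x by (simp add: w_def)
      have "\<bar>t * (w \<bullet> (K *v w))\<bar> \<le> \<bar>t\<bar> * B"
        using B(2)[OF w] by (simp add: abs_mult mult_left_mono)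
      also have "\<dots> < c" using t B by (simp add: field_simps)
      also have "c \<le> w \<bullet> (C *v w)" using umin[OF w] by (simp add: c_def)
      finally have "0 < w \<bullet> (C *v w) + t * (w \<bullet> (K *v w))" by linarith
      then have "0 < w \<bullet> ((C + t *\<^sub>R K) *v w)"
        by (simp add: matrix_vector_mult_add_rdistrib scaleR_matrix_vector_assoc[symmetric] inner_add_right)
      moreover have "x \<bullet> ((C + t *\<^sub>R K) *v x) = (norm x)\<^sup>2 * (w \<bullet> ((C + t *\<^sub>R K) *v w))"
        by (subst (1 2) xw) (simp add: matrix_vector_mult_scaleR power2_eq_square)
      ultimately show ?thesis using x by simp
    qed
    then show "C + t *\<^sub>R K \<in> spd_matrices"
      using sym_matrices_add_scaleR[of C K t] C K by (simp add: spd_matrices_def)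
  qed
qed

lemma has_spd_gradient_unique:
  fixes C :: "real ^ 'm ^ 'm"
  assumes C: "C \<in> spd_matrices"
    and G: "has_spd_gradient f C G" and G': "has_spd_gradient f C G'"
  shows "G = G'"
proof -
  define K where "K = G - G'"
  have K: "K \<in> sym_matrices"
    using sym_matrices_add_scaleR[of G G' "-1"] G G' by (simp add: has_spd_gradient_def K_def)
  obtain e where e: "0 < e" "\<And>t. \<bar>t\<bar> < e \<Longrightarrow> C + t *\<^sub>R K \<in> spd_matrices"
    using spd_matrices_open_direction[OF C K] by blast
  have path: "((\<lambda>t. f (C + t *\<^sub>R K)) has_derivative (\<lambda>t. (t *\<^sub>R K) \<bullet> H)) (at 0)"
    if H: "has_spd_gradient f C H" for H
  proof -
    have g: "((\<lambda>t. C + t *\<^sub>R K) has_derivative (\<lambda>t. t *\<^sub>R K)) (at 0 within ball 0 e)"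
      by (auto intro!: derivative_eq_intros)
    have "(f has_derivative (\<lambda>X. X \<bullet> H)) (at (C + 0 *\<^sub>R K) within (\<lambda>t. C + t *\<^sub>R K) ` ball 0 e)"
      using H e by (auto simp: has_spd_gradient_def intro: has_derivative_subset)
    from has_derivative_in_compose[OF g this]
    show ?thesis using e(1) by (simp add: at_within_open[OF _ open_ball])
  qed
  have "K \<bullet> G = K \<bullet> G'"
    using has_derivative_unique[OF path[OF G] path[OF G']] by (auto dest: fun_cong[of _ _ 1])
  then have "K \<bullet> K = 0" by (simp add: K_def inner_diff_right)
  then show ?thesis by (simp add: K_def)
qed

end

theory Submission
  imports Defs
begin

text \<open>
  Every term of \<open>F\<close> is affine, quadratic or an exponential of an affine map, except \<open>ln (det C)\<close>.
  At the identity, only the identity permutation survives in the derivative of the Leibniz formula,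
  so the derivative of \<open>det\<close> there is the trace; writing \<open>det X = det (X C\<^sup>-\<^sup>1) det C\<close> moves this
  to an arbitrary invertible \<open>C\<close>. On the positive definite cone \<open>det\<close> is positive, because the
  segment from the identity to \<open>C\<close> consists of invertible matrices.
\<close>

section \<open>Adjoints for the trace inner product and the linear building blocks\<close>

lemma inner_matrix_mult_left:
  fixes B :: "real ^ 'b ^ 'a"
  shows "X \<bullet> (B ** Y) = (transpose B ** X) \<bullet> Y"
proof -
  have "X \<bullet> (B ** Y) = trace (B ** (Y ** transpose X))"
    by (subst inner_commute) (simp add: inner_matrix_eq_trace matrix_mul_assoc)
  also have "\<dots> = Y \<bullet> (transpose B ** X)"
    unfolding trace_mul_sym[of B]
    by (simp add: inner_matrix_eq_trace matrix_mul_assoc matrix_transpose_mul)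
  finally show ?thesis by (simp add: inner_commute)
qed

lemma inner_transpose:
  fixes X Y :: "real ^ 'b ^ 'a"
  shows "transpose X \<bullet> transpose Y = X \<bullet> Y"
  unfolding inner_vec_def transpose_def by (simp add: sum.swap[of _ "UNIV :: 'b set"])

text \<open>Transposition is an isometry that reverses products, so this is the left-hand version
  conjugated by it.\<close>

lemma inner_matrix_mult_right:
  fixes B :: "real ^ 'b ^ 'a"
  shows "X \<bullet> (Y ** B) = (X ** transpose B) \<bullet> Y"
proof -
  have "X \<bullet> (Y ** B) = transpose X \<bullet> (transpose B ** transpose Y)"
    by (metis inner_transpose matrix_transpose_mul)
  also have "\<dots> = transpose (X ** transpose B) \<bullet> transpose Y"
    by (simp add: inner_matrix_mult_left matrix_transpose_mul)
  finally show ?thesis by (simp add: inner_transpose)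
qed

lemma inner_diag_matrix:
  fixes M :: "real ^ 'k ^ 'k"
  shows "M \<bullet> diag_matrix v = diag_of M \<bullet> v"
  by (simp add: inner_vec_def diag_matrix_def diag_of_def if_distrib cong: if_cong)

lemma trace_mult_eq_inner:
  fixes M :: "real ^ 'a ^ 'b"
  shows "trace (M ** X) = M \<bullet> transpose X"
  by (simp add: inner_matrix_eq_trace)

lemma inner_matrix_vector_mult_transpose:
  fixes B :: "real ^ 'b ^ 'a"
  shows "h \<bullet> (transpose B *v v) = (B *v h) \<bullet> v"
  by (metis dot_lmul_matrix transpose_matrix_vector transpose_transpose)

text \<open>The two-sided form serves twice: for \<open>A ** X ** transpose A\<close> in the
  exponent of \<open>F\<close>, and with left factor \<open>mat 1\<close> for the right
  multiplication by \<open>matrix_inv C\<close> behind the derivative of \<open>det\<close>.\<close>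

lemma bounded_linear_matrix_mult_both:
  fixes A :: "real ^ 'b ^ 'a" and B :: "real ^ 'd ^ 'c"
  shows "bounded_linear (\<lambda>X. A ** X ** B)"
  unfolding linear_conv_bounded_linear[symmetric]
  by (rule linearI)
    (simp_all add: matrix_matrix_mult_def vec_eq_iff sum.distrib sum_distrib_left algebra_simps)

lemma bounded_linear_diag_of: "bounded_linear (diag_of :: real ^ 'k ^ 'k \<Rightarrow> real ^ 'k)"
  unfolding linear_conv_bounded_linear[symmetric]
  by (rule linearI) (simp_all add: diag_of_def vec_eq_iff)

text \<open>The sum of exponentials has gradient \<open>exp_vec v\<close> at \<open>v\<close>; the
  rest is the chain rule. The domain of \<open>g\<close> is left general so that both the mean and
  the covariance can be the variable.\<close>

lemma has_derivative_sum_exp_vec: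
  fixes g :: "'a::real_normed_vector \<Rightarrow> real ^ 'k"
  assumes "(g has_derivative g') (at x within S)"
  shows "((\<lambda>x. 1 \<bullet> exp_vec (g x)) has_derivative (\<lambda>h. g' h \<bullet> exp_vec (g x))) (at x within S)"
proof -
  have "((\<lambda>x. g x $ i) has_derivative (\<lambda>h. g' h $ i)) (at x within S)" for i
    using bounded_linear.has_derivative[OF bounded_linear_vec_nth assms] .
  then show ?thesis
    unfolding inner_vec_def exp_vec_def
    by (auto intro!: derivative_eq_intros simp: mult_ac)
qed

section \<open>The derivative of the determinant\<close>

lemma has_derivative_det_mat_1:
  "(det has_derivative trace) (at (mat 1 :: real ^ 'm ^ 'm) within S)"
proof -
  let ?P = "{p. p permutes (UNIV :: 'm set)}"
  \<comment> \<open>Product rule applied to each Leibniz term: the factor in row \<open>i\<close> is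
    replaced by an entry of \<open>H\<close>, the others stay at the identity matrix.\<close>
  let ?D = "\<lambda>H :: real ^ 'm ^ 'm. \<Sum>p\<in>?P. of_int (sign p) *
    (\<Sum>i\<in>UNIV. H $ i $ p i * (\<Prod>j\<in>UNIV - {i}. mat 1 $ j $ p j))"
  have entry: "((\<lambda>X. X $ i $ j) has_derivative (\<lambda>H. H $ i $ j)) (at X within S)"
    for X :: "real ^ 'm ^ 'm" and i j
    by (intro bounded_linear.has_derivative[OF bounded_linear_vec_nth] has_derivative_ident)
  have "(det has_derivative ?D) (at (mat 1) within S)"
    unfolding det_def
    by (intro has_derivative_sum has_derivative_mult_right has_derivative_prod entry)
  moreover have "?D = trace"
  proof
    fix H :: "real ^ 'm ^ 'm"
    \<comment> \<open>A permutation other than \<open>id\<close> moves at least two points, so even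
      with row \<open>i\<close> left out an off-diagonal zero of \<open>mat 1\<close> remains in the
      product.\<close>
    have off: "(\<Prod>j\<in>UNIV - {i}. mat 1 $ j $ p j) = (0 :: real)" if p: "p \<in> ?P" "p \<noteq> id" for p and i :: 'm
    proof -
      have "\<exists>j. j \<noteq> i \<and> p j \<noteq> j"
      proof (rule ccontr)
        assume "\<nexists>j. j \<noteq> i \<and> p j \<noteq> j"
        then have fix_p: "p j = j" if "j \<noteq> i" for j using that by blast
        have "inj p" using p by (auto intro: permutes_inj)
        then have "p i = i" using fix_p by (metis injD)
        then show False using fix_p p(2) by (metis eq_id_iff)
      qed
      then obtain j where "j \<in> UNIV - {i}" "p j \<noteq> j" by blast
      then show ?thesis by (intro prod_zero) (auto simp: mat_def intro!: bexI[of _ j])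
    qed
    have "?D H = (\<Sum>p\<in>{id}. of_int (sign p) *
        (\<Sum>i\<in>UNIV. H $ i $ p i * (\<Prod>j\<in>UNIV - {i}. mat 1 $ j $ p j)))"
      by (rule sum.mono_neutral_right) (auto simp: finite_permutations permutes_id off)
    also have "\<dots> = trace H"
      by (simp add: mat_def trace_def sign_id)
    finally show "?D H = trace H" .
  qed
  ultimately show ?thesis by simp
qed

text \<open>\<open>matrix_inv\<close> is a choice of a two-sided inverse, and invertibility says
  that there is one to choose.\<close>

lemma matrix_inv_mult:
  fixes C :: "'a::semiring_1 ^ 'n ^ 'm"
  assumes "invertible C"
  shows "C ** matrix_inv C = mat 1" "matrix_inv C ** C = mat 1"
  using assms someI_ex[of "\<lambda>B. C ** B = mat 1 \<and> B ** C = mat 1"]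
  unfolding invertible_def matrix_inv_def by blast+

text \<open>Jacobi's formula at an invertible matrix.\<close>

lemma has_derivative_det:
  fixes C :: "real ^ 'm ^ 'm"
  assumes "invertible C"
  shows "(det has_derivative (\<lambda>H. det C * trace (H ** matrix_inv C))) (at C within S)"
proof -
  note inv = matrix_inv_mult[OF assms]
  have lin: "((\<lambda>X. X ** matrix_inv C) has_derivative (\<lambda>H. H ** matrix_inv C)) (at C within S)"
    using bounded_linear_matrix_mult_both[of "mat 1" "matrix_inv C"]
    by (intro bounded_linear_imp_has_derivative) simp
  \<comment> \<open>The inner map sends \<open>C\<close> to \<open>mat 1\<close>. The chain rule
    asks for the derivative of \<open>det\<close> there within the image of \<open>S\<close>, which
    is available because the derivative at \<open>mat 1\<close> is known within every set.\<close>
  have "((\<lambda>X. det C * det (X ** matrix_inv C)) has_derivative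
      (\<lambda>H. det C * trace (H ** matrix_inv C))) (at C within S)"
    by (intro has_derivative_mult_right has_derivative_in_compose[OF lin])
      (simp add: inv has_derivative_det_mat_1)
  moreover have "det C * det (X ** matrix_inv C) = det X" for X
  proof -
    have "det (X ** matrix_inv C) * det C = det (X ** (matrix_inv C ** C))"
      by (metis det_mul matrix_mul_assoc)
    then show ?thesis by (simp add: inv mult.commute)
  qed
  ultimately show ?thesis by simp
qed

section \<open>The positive definite cone\<close>

lemma spd_matrices_invertible:
  fixes C :: "real ^ 'm ^ 'm"
  assumes "C \<in> spd_matrices"
  shows "invertible C"
proof -
  \<comment> \<open>The quadratic form vanishes at a kernel vector, which definiteness allows only
    at \<open>0\<close>.\<close>
  have "x = 0" if "C *v x = 0" for x
    using assms that by (force simp: spd_matrices_def)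
  then show ?thesis
    unfolding invertible_left_inverse matrix_left_invertible_ker by blast
qed

text \<open>Keeps the segment from \<open>mat 1\<close> to a positive definite matrix inside the
  cone, as the positivity of \<open>det\<close> requires.\<close>

lemma convex_spd_matrices: "convex (spd_matrices :: (real ^ 'm ^ 'm) set)"
proof (rule convexI)
  fix C D :: "real ^ 'm ^ 'm" and u v :: real
  assume C: "C \<in> spd_matrices" and D: "D \<in> spd_matrices"
    and uv: "0 \<le> u" "0 \<le> v" "u + v = 1"
  have "0 < x \<bullet> ((u *\<^sub>R C + v *\<^sub>R D) *v x)" if "x \<noteq> 0" for x
  proof -
    have "0 < x \<bullet> (C *v x)" "0 < x \<bullet> (D *v x)"
      using C D that by (auto simp: spd_matrices_def)
    moreover have "0 < u \<or> 0 < v" using uv by linarith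
    ultimately have "0 < u * (x \<bullet> (C *v x)) + v * (x \<bullet> (D *v x))"
      using uv by (auto intro: add_pos_nonneg add_nonneg_pos)
    then show ?thesis
      by (simp add: matrix_vector_mult_add_rdistrib scaleR_matrix_vector_assoc[symmetric]
          inner_add_right)
  qed
  then show "u *\<^sub>R C + v *\<^sub>R D \<in> spd_matrices"
    using C D by (simp add: spd_matrices_def sym_matrices_def transpose_def vec_eq_iff)
qed

lemma mat_1_in_spd_matrices: "mat 1 \<in> (spd_matrices :: (real ^ 'm ^ 'm) set)"
  by (simp add: spd_matrices_def sym_matrices_def)

lemma spd_matrices_det_pos:
  fixes C :: "real ^ 'm ^ 'm"
  assumes "C \<in> spd_matrices"
  shows "0 < det C"
proof (rule ccontr)
  assume neg: "\<not> 0 < det C"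
  let ?seg = "closed_segment (mat 1) C"
  have sub: "?seg \<subseteq> spd_matrices"
    using closed_segment_subset[OF mat_1_in_spd_matrices assms convex_spd_matrices] .
  have "continuous_on ?seg det"
    unfolding continuous_on_eq_continuous_within
    using sub has_derivative_continuous[OF has_derivative_det] spd_matrices_invertible by blast
  then have "connected (det ` ?seg)"
    by (intro connected_continuous_image) auto
  moreover have "det C \<in> det ` ?seg" "det (mat 1 :: real ^ 'm ^ 'm) \<in> det ` ?seg"
    by (intro imageI; simp)+
  \<comment> \<open>The image of the segment under \<open>det\<close> is an interval containing 1,
    the value at \<open>mat 1\<close>, and a value that is not positive, the one at
    \<open>C\<close>.\<close>
  ultimately have "0 \<in> det ` ?seg"
    using neg unfolding connected_iff_interval by (metis det_I not_less zero_le_one)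
  then obtain X where "X \<in> ?seg" "det X = 0" by auto
  then show False
    using sub spd_matrices_invertible invertible_det_nz by blast
qed

text \<open>Transposing \<open>C ** matrix_inv C = mat 1\<close> yields a left inverse of
  \<open>C\<close>, and a left inverse agrees with a right inverse.\<close>

lemma transpose_matrix_inv_sym:
  fixes C :: "real ^ 'm ^ 'm"
  assumes "invertible C" and "transpose C = C"
  shows "transpose (matrix_inv C) = matrix_inv C"
proof -
  note inv = matrix_inv_mult[OF assms(1)]
  have "transpose (matrix_inv C) ** C = mat 1"
    by (metis assms(2) inv(1) matrix_transpose_mul transpose_mat)
  then show ?thesis
    by (metis inv(1) matrix_mul_assoc matrix_mul_lid matrix_mul_rid)
qed

lemma spd_matrices_transpose:
  assumes "C \<in> spd_matrices"
  shows "transpose C = C" "transpose (matrix_inv C) = matrix_inv C"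
  using assms transpose_matrix_inv_sym[OF spd_matrices_invertible]
  by (auto simp: spd_matrices_def sym_matrices_def)

section \<open>The gradients in the mean and in the covariance\<close>

lemma has_derivative_F_mean:
  fixes A :: "real ^ 'm ^ 'n"
  assumes "C\<^sub>0 \<in> spd_matrices"
  shows "GDERIV (\<lambda>x. F A y \<mu>\<^sub>0 C\<^sub>0 x C) xb :>
      transpose A *v real_vec y
      - transpose A *v exp_vec (A *v xb + (1/2) *\<^sub>R diag_of (A ** C ** transpose A))
      - matrix_inv C\<^sub>0 *v (xb - \<mu>\<^sub>0)"
proof -
  let ?K = "matrix_inv C\<^sub>0"
  let ?w = "(1/2) *\<^sub>R diag_of (A ** C ** transpose A)"
  have mv: "((\<lambda>x. M *v f x) has_derivative (\<lambda>h. M *v f' h)) (at xb)"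
    if "(f has_derivative f') (at xb)" for M :: "real ^ 'm ^ 'k" and f f'
    by (rule bounded_linear.has_derivative[OF matrix_vector_mul_bounded_linear that])
  have lin: "((\<lambda>x. A *v x + ?w) has_derivative (\<lambda>h. A *v h)) (at xb)"
    using has_derivative_add[OF mv[OF has_derivative_ident, of A] has_derivative_const[of ?w]]
    by simp
  have lin_diff: "((\<lambda>x. x - \<mu>\<^sub>0) has_derivative (\<lambda>h. h)) (at xb)"
    using has_derivative_diff[OF has_derivative_ident has_derivative_const[of \<mu>\<^sub>0]] by simp
  \<comment> \<open>Symmetry of the inverse makes the two halves of the product rule equal, which
    cancels the factor 1/2 of the quadratic term.\<close>
  have K_sym: "(xb - \<mu>\<^sub>0) \<bullet> (?K *v h) = h \<bullet> (?K *v (xb - \<mu>\<^sub>0))" for h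
    using inner_matrix_vector_mult_transpose[of h ?K "xb - \<mu>\<^sub>0"] spd_matrices_transpose[OF assms]
    by (simp add: inner_commute)
  \<comment> \<open>The zeros stand for the summands of \<open>F\<close> that are constant in the
    mean, so that the derivative matches \<open>F\<close> term by term.\<close>
  have "((\<lambda>x. F A y \<mu>\<^sub>0 C\<^sub>0 x C) has_derivative
      (\<lambda>h. real_vec y \<bullet> (A *v h) - (A *v h) \<bullet> exp_vec (A *v xb + ?w)
        - 1/2 * ((xb - \<mu>\<^sub>0) \<bullet> (?K *v h) + h \<bullet> (?K *v (xb - \<mu>\<^sub>0))) - 0 + 0 - 0 + 0 - 0)) (at xb)"
    unfolding F_def
    by (intro has_derivative_add has_derivative_diff has_derivative_const has_derivative_mult_right
        has_derivative_inner has_derivative_inner_right mv lin lin_diff has_derivative_ident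
        has_derivative_sum_exp_vec)
  \<comment> \<open>Moving \<open>A\<close> across the inner product as \<open>transpose A\<close>
    leaves \<open>h\<close> alone on one side; the other side is the gradient.\<close>
  then show ?thesis
    unfolding gderiv_def K_sym
    by (simp add: inner_diff_right inner_matrix_vector_mult_transpose
        inner_commute[of "real_vec y"] del: transpose_matrix_vector)
qed

lemma has_spd_gradient_F_covariance:
  fixes A :: "real ^ 'm ^ 'n"
  assumes C0: "C\<^sub>0 \<in> spd_matrices" and C: "C \<in> spd_matrices"
  shows "has_spd_gradient (\<lambda>X. F A y \<mu>\<^sub>0 C\<^sub>0 xb X) C
      ((1/2) *\<^sub>R (- (transpose A
            ** diag_matrix (exp_vec (A *v xb + (1/2) *\<^sub>R diag_of (A ** C ** transpose A)))
            ** A)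
          - matrix_inv C\<^sub>0 + matrix_inv C))"
proof -
  let ?e = "exp_vec (A *v xb + (1/2) *\<^sub>R diag_of (A ** C ** transpose A))"
  let ?E = "transpose A ** diag_matrix ?e ** A"
  have diag: "transpose (diag_matrix ?e) = diag_matrix ?e"
    by (auto simp: diag_matrix_def transpose_def vec_eq_iff)
  have E: "transpose ?E = ?E"
    by (simp add: matrix_transpose_mul diag matrix_mul_assoc)
  \<comment> \<open>The gradient on the cone is by definition the symmetric representative of the
    derivative.\<close>
  have "(1/2) *\<^sub>R (- ?E - matrix_inv C\<^sub>0 + matrix_inv C) \<in> sym_matrices"
    using E spd_matrices_transpose(2)[OF C0] spd_matrices_transpose(2)[OF C]
    by (simp add: sym_matrices_def transpose_def vec_eq_iff)
  moreover have "((\<lambda>X. F A y \<mu>\<^sub>0 C\<^sub>0 xb X) has_derivative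
      (\<lambda>H. H \<bullet> ((1/2) *\<^sub>R (- ?E - matrix_inv C\<^sub>0 + matrix_inv C)))) (at C within spd_matrices)"
  proof -
    have lin: "((\<lambda>X. A *v xb + (1/2) *\<^sub>R diag_of (A ** X ** transpose A)) has_derivative
        (\<lambda>H. (1/2) *\<^sub>R diag_of (A ** H ** transpose A))) (at C within spd_matrices)"
      by (auto intro!: derivative_eq_intros bounded_linear_imp_has_derivative
          bounded_linear_compose[OF bounded_linear_diag_of bounded_linear_matrix_mult_both])
    have tr: "trace (matrix_inv C\<^sub>0 ** X) = X \<bullet> matrix_inv C\<^sub>0" for X
      using spd_matrices_transpose(2)[OF C0]
      by (metis inner_commute inner_transpose trace_mult_eq_inner)
    have det: "(det has_derivative (\<lambda>H. det C * (H \<bullet> matrix_inv C))) (at C within spd_matrices)"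
      using has_derivative_det[OF spd_matrices_invertible[OF C], of spd_matrices]
        spd_matrices_transpose(2)[OF C]
      by (simp add: trace_mult_eq_inner)
    \<comment> \<open>The factor \<open>det C\<close> of Jacobi's formula cancels against the
      derivative of \<open>ln\<close> at \<open>det C\<close>, which is positive.\<close>
    have ln_det: "((\<lambda>X. ln (det X)) has_derivative
        (\<lambda>H. H \<bullet> matrix_inv C)) (at C within spd_matrices)"
      using has_derivative_ln[OF spd_matrices_det_pos[OF C] det] spd_matrices_det_pos[OF C]
      by (simp add: field_simps)
    \<comment> \<open>Read from right to left: the outer factors of \<open>?E\<close> pass over to
      \<open>H\<close>, and what remains is paired with a diagonal matrix, which sees only its
      diagonal.\<close>
    have quad: "diag_of (A ** H ** transpose A) \<bullet> ?e = H \<bullet> ?E" for H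
      by (simp only: inner_matrix_mult_right[of H] inner_matrix_mult_left[of "H ** _"]
          inner_diag_matrix transpose_transpose matrix_mul_assoc)
    \<comment> \<open>Here the zeros come from the summands constant in the covariance, among them
      both terms that involve only the mean.\<close>
    have "((\<lambda>X. F A y \<mu>\<^sub>0 C\<^sub>0 xb X) has_derivative
        (\<lambda>H. 0 - (1/2) *\<^sub>R diag_of (A ** H ** transpose A) \<bullet> ?e - 0
          - 1/2 * (H \<bullet> matrix_inv C\<^sub>0) + 1/2 * (H \<bullet> matrix_inv C)
          - 0 + 0 - 0)) (at C within spd_matrices)"
      unfolding F_def tr
      by (intro has_derivative_add has_derivative_diff has_derivative_const
          has_derivative_mult_right has_derivative_inner_left has_derivative_ident
          has_derivative_sum_exp_vec lin ln_det)
    then show ?thesis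
      by (simp add: quad inner_add_right inner_diff_right algebra_simps)
  qed
  ultimately show ?thesis unfolding has_spd_gradient_def by blast
qed

theorem theorem3p3:
  fixes A :: "real ^ 'm ^ 'n" and y :: "nat ^ 'n"
    and \<mu>\<^sub>0 :: "real ^ 'm" and C\<^sub>0 :: "real ^ 'm ^ 'm"
    and xb :: "real ^ 'm" and C :: "real ^ 'm ^ 'm"
  assumes "C\<^sub>0 \<in> spd_matrices" and "C \<in> spd_matrices"
  shows "GDERIV (\<lambda>x. F A y \<mu>\<^sub>0 C\<^sub>0 x C) xb :>
      transpose A *v real_vec y
      - transpose A *v exp_vec (A *v xb + (1/2) *\<^sub>R diag_of (A ** C ** transpose A))
      - matrix_inv C\<^sub>0 *v (xb - \<mu>\<^sub>0)
    \<and> has_spd_gradient (\<lambda>X. F A y \<mu>\<^sub>0 C\<^sub>0 xb X) C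
      ((1/2) *\<^sub>R (- (transpose A
            ** diag_matrix (exp_vec (A *v xb + (1/2) *\<^sub>R diag_of (A ** C ** transpose A)))
            ** A)
          - matrix_inv C\<^sub>0 + matrix_inv C))"
  using has_derivative_F_mean[OF assms(1)] has_spd_gradient_F_covariance[OF assms] by blast

end
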